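(* Let $X=\mathbb{R}$ and let $G:\mathbb{R}\to\mathbb{R}$ be linear and invertible. Consider the equation $C=(GC)^{\circ}$ with an unknown $\emptyset\neq C\subseteq\mathbb{R}$. (a) If $G(x)=\gamma x$ for each $x\in\mathbb{R}$, where $\gamma>0$ is fixed, then $C=\{x\in\mathbb{R}:|x|\leq 1/\sqrt{\gamma}\}$ is the unique solution of the equation. (b) If $G(x)=\gamma x$ for each $x\in\mathbb{R}$, where $\gamma<0$ is fixed, then the set of solutions of the equation consists of exactly the following sets: (i) the sets $C_b:=\left[\frac{1}{\gamma b},b\right]$, where $b>0$ is arbitrary (infinitely many bounded, closed and convex sets having $0$ in their interiors); and (ii) two unbounded sets which contain $0$ on their boundaries, namely the rays $C_{-}:=(-\infty,0]$ and $C_{+}:=[0,\infty)$.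
   Context: For $\emptyset\neq S\subseteq\mathbb{R}$, $S^{\circ}:=\{x^*\in\mathbb{R}: x^*s\leq 1\ \ \forall s\in S\}$ and $GS:=\{G(s):s\in S\}$. *)

theory Defs
  imports "HOL-Analysis.Analysis"
begin

(* The polar is only meant for nonempty S; on the empty set this total function returns UNIV. *)
definition polar :: "real set \<Rightarrow> real set" where
  "polar S = {y. \<forall>s\<in>S. y * s \<le> 1}"

definition polar_solutions :: "(real \<Rightarrow> real) \<Rightarrow> real set set" where
  "polar_solutions G = {C. C \<noteq> {} \<and> C = polar (G ` C)}"

end

theory Submission
  imports Defs
begin

text \<open>
  With \<open>G x = \<gamma> * x\<close>, call \<open>x\<close> and \<open>y\<close> related if \<open>y * (\<gamma> * x) \<le> 1\<close>; this relation is symmetric.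
  The equation \<open>C = (G C)\<^sup>\<circ>\<close> says that \<open>C\<close> consists of exactly those points that are related to
  every point of \<open>C\<close>. In particular every point of \<open>C\<close> is related to itself.

  For \<open>\<gamma> > 0\<close>, relating a point of \<open>C\<close> to itself gives \<open>\<gamma> * x\<^sup>2 \<le> 1\<close>, so \<open>C\<close> lies in the interval
  of radius \<open>1 / sqrt \<gamma>\<close>. Any two points of that interval are related, so each of its points
  is related to every point of \<open>C\<close> and therefore belongs to \<open>C\<close> (\<open>positive_solution_iff\<close>).

  For \<open>\<gamma> < 0\<close>, two points of the same sign are always related, so a constraint only ties a
  positive point to a negative one. As a polar, \<open>C\<close> is a closed interval containing \<open>0\<close>; hence it
  is determined by its two ends, and each end determines the other. An upper end \<open>b > 0\<close> forces the
  lower end \<open>1 / (\<gamma> * b)\<close>; the degenerate upper ends \<open>0\<close> and \<open>\<infinity>\<close> force the lower ends \<open>-\<infinity>\<close>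
  and \<open>0\<close>, which gives the two rays (\<open>negative_solution_cases\<close>). That each of these sets does
  solve the equation is an evaluation of its polar (\<open>interval_is_negative_solution\<close>,
  \<open>nonpos_ray_is_negative_solution\<close>, \<open>nonneg_ray_is_negative_solution\<close>).
\<close>

lemma mem_polar_image_mult:
  "y \<in> polar ((*) \<gamma> ` C) \<longleftrightarrow> (\<forall>x\<in>C. y * (\<gamma> * x) \<le> 1)"
  by (simp add: polar_def)

lemma zero_in_polar: "0 \<in> polar S"
  by (simp add: polar_def)

text \<open>A polar is an intersection of sets \<open>{y. y * s \<le> 1}\<close>, each a closed half-line or the whole line.\<close>

lemma closed_polar: "closed (polar S)"
proof -
  have "polar S = (\<Inter>s\<in>S. {y. y * s \<le> 1})"
    by (auto simp: polar_def)
  moreover have "closed {y. y * s \<le> 1}" for s :: real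
    by (intro closed_Collect_le continuous_intros)
  ultimately show ?thesis by auto
qed

lemma scale_mem_polar:
  assumes "y \<in> polar S" "0 \<le> t" "t \<le> 1"
  shows "t * y \<in> polar S"
proof -
  have "(t * y) * s \<le> 1" if "s \<in> S" for s
  proof -
    have "t * (y * s) \<le> t * 1"
      using assms that by (intro mult_left_mono) (auto simp: polar_def)
    then show ?thesis using assms by (simp add: mult.assoc)
  qed
  then show ?thesis by (simp add: polar_def)
qed

lemma polar_contains_between_zero:
  assumes "y \<in> polar S" "0 \<le> x" "x \<le> y"
  shows "x \<in> polar S"
proof (cases "y = 0")
  case True
  then show ?thesis using assms by simp
next
  case False
  then show ?thesis
    using scale_mem_polar[of y S "x / y"] assms by simp
qed

text \<open>
  The radius \<open>1 / sqrt \<gamma>\<close> is the largest modulus of a point related to itself, and for two points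
  of at most this modulus the constraint \<open>y * (\<gamma> * x) \<le> 1\<close> holds automatically.
\<close>

lemma positive_solution_iff:
  fixes \<gamma> :: real
  assumes "\<gamma> > 0"
  shows "C = polar ((*) \<gamma> ` C) \<longleftrightarrow> C = {x. \<bar>x\<bar> \<le> 1 / sqrt \<gamma>}"
proof -
  let ?r = "1 / sqrt \<gamma>"
  have r: "?r > 0" "\<gamma> * ?r\<^sup>2 = 1"
    using assms by (simp_all add: power_divide)
  have related: "y * (\<gamma> * x) \<le> 1" if "\<bar>x\<bar> \<le> ?r" "\<bar>y\<bar> \<le> ?r" for x y
  proof -
    have "y * x \<le> \<bar>y\<bar> * \<bar>x\<bar>" by (metis abs_ge_self abs_mult)
    also have "\<dots> \<le> ?r * ?r" using that r by (intro mult_mono) auto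
    finally have "\<gamma> * (y * x) \<le> \<gamma> * (?r * ?r)"
      using assms by (intro mult_left_mono) auto
    then show ?thesis using r by (simp add: power2_eq_square mult_ac)
  qed
  have self: "\<bar>y\<bar> \<le> ?r" if "y * (\<gamma> * y) \<le> 1" for y
  proof -
    have "\<gamma> * y\<^sup>2 \<le> \<gamma> * ?r\<^sup>2"
      using that r by (simp add: power2_eq_square mult_ac)
    then have "y\<^sup>2 \<le> ?r\<^sup>2" using assms by simp
    then have "\<bar>y\<bar> \<le> \<bar>?r\<bar>" by (simp only: abs_le_square_iff)
    then show ?thesis using r(1) by (simp only: abs_of_pos)
  qed
  show ?thesis
  proof
    assume C: "C = polar ((*) \<gamma> ` C)"
    have mem: "y \<in> C \<longleftrightarrow> (\<forall>x\<in>C. y * (\<gamma> * x) \<le> 1)" for y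
      using C mem_polar_image_mult by blast
    have sub: "\<bar>y\<bar> \<le> ?r" if "y \<in> C" for y
      using mem self that by blast
    then have "y \<in> C" if "\<bar>y\<bar> \<le> ?r" for y
      using mem related that by blast
    with sub show "C = {x. \<bar>x\<bar> \<le> ?r}" by blast
  next
    assume C: "C = {x. \<bar>x\<bar> \<le> ?r}"
    have "y \<in> C \<longleftrightarrow> (\<forall>x\<in>C. y * (\<gamma> * x) \<le> 1)" for y
    proof
      assume "y \<in> C"
      then show "\<forall>x\<in>C. y * (\<gamma> * x) \<le> 1" using C related by blast
    next
      assume *: "\<forall>x\<in>C. y * (\<gamma> * x) \<le> 1"
      \<comment> \<open>\<open>y\<close> is not yet known to lie in \<open>C\<close>, so it is tested against the ends of \<open>C\<close> instead of itself.\<close>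
      have "?r \<in> C" "- ?r \<in> C" using C r by auto
      then have "y * (\<gamma> * ?r) \<le> 1" "y * (\<gamma> * (- ?r)) \<le> 1" using * by blast+
      then have "y * (\<gamma> * ?r) \<le> ?r * (\<gamma> * ?r)" "(- y) * (\<gamma> * ?r) \<le> ?r * (\<gamma> * ?r)"
        using r by (simp_all add: power2_eq_square mult_ac)
      moreover have "\<gamma> * ?r > 0" using assms r by simp
      ultimately have "y \<le> ?r" "- y \<le> ?r"
        using mult_le_cancel_right_pos by blast+
      then show "y \<in> C" using C by simp
    qed
    then show "C = polar ((*) \<gamma> ` C)"
      using mem_polar_image_mult by blast
  qed
qed

text \<open>
  The constraint \<open>y * (\<gamma> * x) \<le> 1\<close> is affine in \<open>x\<close>, so only the two ends of the interval matter;
  each end yields one bound on \<open>y\<close>, namely the opposite end.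
\<close>

lemma interval_is_negative_solution:
  fixes \<gamma> b :: real
  assumes "\<gamma> < 0" "b > 0"
  shows "{1 / (\<gamma> * b)..b} = polar ((*) \<gamma> ` {1 / (\<gamma> * b)..b})"
proof -
  let ?a = "1 / (\<gamma> * b)"
  have neg: "\<gamma> * b < 0" using assms by (simp add: mult_neg_pos)
  then have a: "?a < 0" by simp
  have upper: "y * (\<gamma> * ?a) \<le> 1 \<longleftrightarrow> y \<le> b" for y
    using assms by (simp add: field_simps)
  have lower: "y * (\<gamma> * b) \<le> 1 \<longleftrightarrow> ?a \<le> y" for y
    using neg by (simp add: neg_divide_le_eq)
  have "y \<in> polar ((*) \<gamma> ` {?a..b}) \<longleftrightarrow> y * (\<gamma> * ?a) \<le> 1 \<and> y * (\<gamma> * b) \<le> 1" for y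
  proof
    assume "y \<in> polar ((*) \<gamma> ` {?a..b})"
    moreover have "?a \<in> {?a..b}" "b \<in> {?a..b}"
      using less_imp_le[OF less_trans[OF a assms(2)]] by (simp_all only: atLeastAtMost_iff order_refl)
    ultimately show "y * (\<gamma> * ?a) \<le> 1 \<and> y * (\<gamma> * b) \<le> 1"
      unfolding mem_polar_image_mult by blast
  next
    assume ends: "y * (\<gamma> * ?a) \<le> 1 \<and> y * (\<gamma> * b) \<le> 1"
    have "y * (\<gamma> * x) \<le> 1" if x: "x \<in> {?a..b}" for x
    proof (cases "y * \<gamma> \<ge> 0")
      case True
      then have "(y * \<gamma>) * x \<le> (y * \<gamma>) * b"
        using x by (intro mult_left_mono) auto
      then show ?thesis using ends by (simp only: mult.assoc) linarith
    next
      case False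
      then have "(y * \<gamma>) * x \<le> (y * \<gamma>) * ?a"
        using x by (intro mult_left_mono_neg) auto
      then show ?thesis using ends by (simp only: mult.assoc) linarith
    qed
    then show "y \<in> polar ((*) \<gamma> ` {?a..b})"
      unfolding mem_polar_image_mult by blast
  qed
  then show ?thesis
    by (simp only: upper lower set_eq_iff atLeastAtMost_iff conj_commute simp_thms)
qed

lemma nonpos_ray_is_negative_solution:
  fixes \<gamma> :: real
  assumes "\<gamma> < 0"
  shows "{..0} = polar ((*) \<gamma> ` {..0})"
proof -
  have "y \<le> 0 \<longleftrightarrow> (\<forall>x\<in>{..0}. y * (\<gamma> * x) \<le> 1)" for y
  proof
    assume "y \<le> 0"
    have "y * (\<gamma> * x) \<le> 0" if "x \<le> 0" for x
      using \<open>y \<le> 0\<close> assms that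
      by (intro mult_nonpos_nonneg mult_nonpos_nonpos) auto
    then show "\<forall>x\<in>{..0}. y * (\<gamma> * x) \<le> 1"
      by (meson atMost_iff order_trans zero_le_one)
  next
    assume *: "\<forall>x\<in>{..0}. y * (\<gamma> * x) \<le> 1"
    show "y \<le> 0"
    proof (rule ccontr)
      assume "\<not> y \<le> 0"
      then have "y * \<gamma> < 0" using assms by (simp add: mult_pos_neg)
      \<comment> \<open>The point at which the linear function \<open>x \<mapsto> y * \<gamma> * x\<close> takes the value \<open>2\<close>.\<close>
      then have "2 / (y * \<gamma>) \<in> {..0}" by (simp add: divide_nonneg_neg)
      then have "y * (\<gamma> * (2 / (y * \<gamma>))) \<le> 1" using * by blast
      then show False using \<open>y * \<gamma> < 0\<close> by (auto simp: mult_less_0_iff)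
    qed
  qed
  then show ?thesis using mem_polar_image_mult by blast
qed

text \<open>
  Reflecting both variables in \<open>0\<close> preserves the relation \<open>y * (\<gamma> * x) \<le> 1\<close>, hence the set of
  solutions. This exchanges the two rays.
\<close>

lemma polar_image_mult_uminus:
  "polar ((*) \<gamma> ` uminus ` C) = uminus ` polar ((*) \<gamma> ` C)"
proof -
  have "y \<in> polar ((*) \<gamma> ` uminus ` C) \<longleftrightarrow> - y \<in> polar ((*) \<gamma> ` C)" for y
    by (simp add: mem_polar_image_mult)
  then show ?thesis by (force simp: image_iff)
qed

lemma nonneg_ray_is_negative_solution:
  fixes \<gamma> :: real
  assumes "\<gamma> < 0"
  shows "{0..} = polar ((*) \<gamma> ` {0..})"
proof -
  have "uminus ` {..0::real} = {0..}" by simp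
  then show ?thesis
    using polar_image_mult_uminus[of \<gamma> "{..0}"] nonpos_ray_is_negative_solution[OF assms]
    by simp
qed

text \<open>
  The case distinction is on the supremum of \<open>C\<close>. Since points of the same sign never constrain
  each other, the negative part of \<open>C\<close> can be read off from the positive part, and the
  nonnegative part is an interval starting at \<open>0\<close>, so knowing its end is enough.
\<close>

lemma negative_solution_cases:
  fixes \<gamma> :: real
  assumes "\<gamma> < 0" and C: "C = polar ((*) \<gamma> ` C)"
  obtains b where "b > 0" "C = {1 / (\<gamma> * b)..b}" | "C = {..0}" | "C = {0..}"
proof -
  have mem: "y \<in> C \<longleftrightarrow> (\<forall>x\<in>C. y * (\<gamma> * x) \<le> 1)" for y
    using C mem_polar_image_mult by blast
  have zero: "0 \<in> C" using C zero_in_polar by metis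
  have nonneg_mem: "x \<in> C" if "y \<in> C" "0 \<le> x" "x \<le> y" for x y
    using C polar_contains_between_zero that by metis
  have nonpos_mem: "y \<in> C \<longleftrightarrow> (\<forall>x\<in>C. x > 0 \<longrightarrow> y * (\<gamma> * x) \<le> 1)" if "y \<le> 0" for y
  proof
    assume *: "\<forall>x\<in>C. x > 0 \<longrightarrow> y * (\<gamma> * x) \<le> 1"
    have "y * (\<gamma> * x) \<le> 0" if "x \<le> 0" for x
      using \<open>y \<le> 0\<close> assms that
      by (intro mult_nonpos_nonneg mult_nonpos_nonpos) auto
    then have "y * (\<gamma> * x) \<le> 1" if "x \<in> C" for x
      using * that by (cases "x > 0") (auto intro: order_trans[of _ 0])
    then show "y \<in> C" using mem by blast
  qed (use mem in blast)
  show thesis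
  proof (cases "bdd_above C")
    case False
    have nonneg: "x \<in> C" if x: "x \<ge> 0" for x
    proof -
      obtain y where "y \<in> C" "x < y" using False by (meson bdd_above.I not_le)
      then show ?thesis using nonneg_mem x by auto
    qed
    have "y \<in> polar ((*) \<gamma> ` {0..})" if "y \<in> C" for y
      using mem[of y] that nonneg unfolding mem_polar_image_mult by simp
    then have "C \<subseteq> {0..}"
      using nonneg_ray_is_negative_solution[OF assms(1)] by blast
    then have "C = {0..}" using nonneg by auto
    then show thesis using that by blast
  next
    case True
    define b where "b = Sup C"
    have "closed C" using C closed_polar by metis
    then have b: "b \<in> C"
      unfolding b_def using True zero by (intro closed_contains_Sup) auto
    have upper: "x \<le> b" if "x \<in> C" for x
      unfolding b_def using True that by (intro cSup_upper)
    have "b \<ge> 0" using upper zero by blast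
    show thesis
    proof (cases "b = 0")
      case True
      have "y \<in> C" if "y \<le> 0" for y
        using nonpos_mem[OF that] upper True by force
      then have "C = {..0}" using upper True by auto
      then show thesis using that by blast
    next
      case False
      then have b_pos: "b > 0" using \<open>b \<ge> 0\<close> by simp
      then have neg: "\<gamma> * b < 0" using assms by (simp add: mult_neg_pos)
      have lower: "y * (\<gamma> * b) \<le> 1 \<longleftrightarrow> 1 / (\<gamma> * b) \<le> y" for y
        using neg by (simp add: neg_divide_le_eq)
      have "y \<in> C \<longleftrightarrow> 1 / (\<gamma> * b) \<le> y \<and> y \<le> b" for y
      proof (cases "y \<ge> 0")
        case True
        have "1 / (\<gamma> * b) < 0" using neg by simp
        then have "1 / (\<gamma> * b) \<le> y" using True by linarith
        then show ?thesis using nonneg_mem[OF b True] upper by blast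
      next
        case False
        \<comment> \<open>For \<open>y < 0\<close> the strongest constraint from a point of \<open>C\<close> is the one from \<open>b\<close>.\<close>
        have strongest: "y * (\<gamma> * x) \<le> y * (\<gamma> * b)" if "x \<in> C" for x
          using False assms upper[OF that] by (intro mult_left_mono_neg) auto
        have "y \<in> C \<longleftrightarrow> y * (\<gamma> * b) \<le> 1"
          unfolding mem[of y] using b by (meson order_trans strongest)
        then show ?thesis using lower False b_pos by auto
      qed
      then have "C = {1 / (\<gamma> * b)..b}"
        by (simp only: set_eq_iff atLeastAtMost_iff simp_thms)
      with b_pos show thesis by (rule that(1))
    qed
  qed
qed

lemma infinite_negative_solution_intervals:
  fixes \<gamma> :: real
  assumes "\<gamma> < 0"
  shows "infinite {{1 / (\<gamma> * b)..b} | b. b > 0}"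
proof -
  have "inj_on (\<lambda>b. {1 / (\<gamma> * b)..b}) {0<..}"
  proof (rule inj_onI)
    fix b c :: real
    assume bc: "b \<in> {0<..}" "c \<in> {0<..}" and eq: "{1 / (\<gamma> * b)..b} = {1 / (\<gamma> * c)..c}"
    have "1 / (\<gamma> * d) \<le> d" if "d > 0" for d
      using assms that by (meson divide_nonneg_neg le_less_trans less_imp_le mult_neg_pos zero_le_one)
    then show "b = c" using eq bc Icc_eq_Icc by auto
  qed
  moreover have "infinite {0::real<..}" by (rule infinite_Ioi)
  ultimately have "infinite ((\<lambda>b. {1 / (\<gamma> * b)..b}) ` {0<..})"
    using finite_imageD by blast
  moreover have "(\<lambda>b. {1 / (\<gamma> * b)..b}) ` {0<..} = {{1 / (\<gamma> * b)..b} | b. b > 0}"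
    by auto
  ultimately show ?thesis by simp
qed

lemma rays_unbounded_with_zero_on_frontier:
  assumes "C \<in> {{..0::real}, {0..}}"
  shows "\<not> bounded C \<and> 0 \<in> C \<and> 0 \<in> frontier C"
proof -
  have "\<not> bounded {..0::real}" "\<not> bounded {0::real..}"
    by (metis bounded_subset_cbox_symmetric box_real(2) not_Iic_le_Icc)
      (metis bounded_subset_cbox_symmetric box_real(2) not_Ici_le_Icc)
  moreover have "frontier {..0::real} = {0}" "frontier {0::real..} = {0}"
    by (auto simp: frontier_def)
  ultimately show ?thesis using assms by auto
qed

theorem proposition5p1:
  fixes G :: "real \<Rightarrow> real"
  assumes "linear G" and "bij G"
  shows
    "(\<forall>\<gamma>>0. (\<forall>x. G x = \<gamma> * x) \<longrightarrow>
        polar_solutions G = {{x. \<bar>x\<bar> \<le> 1 / sqrt \<gamma>}}) \<and>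
     (\<forall>\<gamma><0. (\<forall>x. G x = \<gamma> * x) \<longrightarrow>
        polar_solutions G = {{1 / (\<gamma> * b)..b} | b. b > 0} \<union> {{..0}, {0..}} \<and>
        infinite {{1 / (\<gamma> * b)..b} | b. b > 0} \<and>
        (\<forall>b>0. bounded {1 / (\<gamma> * b)..b} \<and> closed {1 / (\<gamma> * b)..b} \<and>
                convex {1 / (\<gamma> * b)..b} \<and> 0 \<in> interior {1 / (\<gamma> * b)..b}) \<and>
        {..0::real} \<noteq> {0..} \<and>
        (\<forall>C\<in>{{..0::real}, {0..}}. \<not> bounded C \<and> 0 \<in> C \<and> 0 \<in> frontier C))"
proof (intro conjI allI impI)
  fix \<gamma> :: real
  assume "\<gamma> > 0" and "\<forall>x. G x = \<gamma> * x"
  then have G: "G = (*) \<gamma>" by auto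
  have "0 \<in> {x. \<bar>x\<bar> \<le> 1 / sqrt \<gamma>}" using \<open>\<gamma> > 0\<close> by simp
  then show "polar_solutions G = {{x. \<bar>x\<bar> \<le> 1 / sqrt \<gamma>}}"
    unfolding polar_solutions_def G positive_solution_iff[OF \<open>\<gamma> > 0\<close>] by blast
next
  fix \<gamma> :: real
  assume \<gamma>: "\<gamma> < 0" and "\<forall>x. G x = \<gamma> * x"
  then have G: "G = (*) \<gamma>" by auto
  have neg: "1 / (\<gamma> * b) < 0" if "b > 0" for b
    using \<gamma> that by (simp add: mult_neg_pos)
  show "polar_solutions G = {{1 / (\<gamma> * b)..b} | b. b > 0} \<union> {{..0}, {0..}}"
  proof (intro equalityI subsetI)
    fix C assume "C \<in> polar_solutions G"
    then have "C = polar ((*) \<gamma> ` C)" by (simp add: polar_solutions_def G)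
    with \<gamma> show "C \<in> {{1 / (\<gamma> * b)..b} | b. b > 0} \<union> {{..0}, {0..}}"
      by (cases rule: negative_solution_cases) auto
  next
    fix C assume "C \<in> {{1 / (\<gamma> * b)..b} | b. b > 0} \<union> {{..0}, {0..}}"
    then have "C = polar ((*) \<gamma> ` C)"
      using interval_is_negative_solution[OF \<gamma>] nonpos_ray_is_negative_solution[OF \<gamma>]
        nonneg_ray_is_negative_solution[OF \<gamma>] by blast
    then show "C \<in> polar_solutions G"
      using zero_in_polar unfolding polar_solutions_def G by blast
  qed
  show "infinite {{1 / (\<gamma> * b)..b} | b. b > 0}"
    using \<gamma> by (rule infinite_negative_solution_intervals)
  show "bounded {1 / (\<gamma> * b)..b}" "closed {1 / (\<gamma> * b)..b}" "convex {1 / (\<gamma> * b)..b}" for b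
    by simp_all
  show "0 \<in> interior {1 / (\<gamma> * b)..b}" if "b > 0" for b
    using neg[OF that] that by (simp add: interior_atLeastAtMost_real)
  have "(1::real) \<in> {0..}" "(1::real) \<notin> {..0}" by simp_all
  then show "{..0::real} \<noteq> {0..}" by blast
  show "\<forall>C\<in>{{..0::real}, {0..}}. \<not> bounded C \<and> 0 \<in> C \<and> 0 \<in> frontier C"
    using rays_unbounded_with_zero_on_frontier by blast
qed

end
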